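(* Let $\kappa$ be a strongly inaccessible cardinal, and let $\mathbb{F}$ be an abelian group with the following property: whenever $C\leq \mathbb{F}$ is a subgroup of size less than $\kappa$, then $C$ is contained in an algebraically compact direct summand $D$ of $\mathbb{F}$ such that $\mathbb{F}/D$ contains, for every infinite cardinal $\lambda<\kappa$, a pure subgroup isomorphic to $\mathbb{G}_\lambda$. Then $\mathbb{F}$ is pure-injective for the class of all abelian groups of size less than $\kappa$.
   Context: All groups are abelian. A subgroup $A\leq B$ is pure if for every $a\in A$ and every integer $k\geq 1$, if $a=k\cdot b$ for some $b\in B$, then $a=k\cdot a'$ for some $a'\in A$. A pure embedding is an injective homomorphism whose image is a pure subgroup of the codomain. A group $A$ is algebraically compact if it is a direct summand of every group $G$ containing $A$ as a pure subgroup. A co-cyclic group is a group isomorphic to $\mathbb{Z}(p^n)$ for some prime $p$ and some $n\in\mathbb N\cup\{\infty\}$, where $\mathbb{Z}(p^n)$ for finite $n$ is the cyclic group of order $p^n$ and $\mathbb{Z}(p^\infty)$ is the quasi-cyclic (Prüfer) $p$-group. For an infinite cardinal $\lambda$, $\mathbb{G}_\lambda$ denotes the (full) direct product of co-cyclic groups in which each isomorphism type of a co-cyclic group appears exactly $\lambda$ many times as a factor. A group $\mathbb A$ is pure-injective for a class $\mathcal K$ of groups if for all $B,C\in\mathcal K$ with $B$ a pure subgroup of $C$, every pure embedding $f:B\to\mathbb A$ extends to a pure embedding $\overline f:C\to\mathbb A$. (This differs from the usual algebraic meaning of "pure-injective".) *)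

theory Defs
  imports
    "HOL-Algebra.Product_Groups"
    "HOL-Computational_Algebra.Primes"
    "HOL-Library.Extended_Nat"
begin

unbundle cardinal_syntax

(* Abelian groups are the commutative groups of HOL-Algebra, written multiplicatively:
   k * b becomes b [^] k. *)

definition pure_subgroup :: "'a set \<Rightarrow> 'a monoid \<Rightarrow> bool" where
  "pure_subgroup A B \<longleftrightarrow> subgroup A B \<and>
     (\<forall>a\<in>A. \<forall>k::nat. k \<ge> 1 \<longrightarrow>
        (\<exists>b\<in>carrier B. a = b [^]\<^bsub>B\<^esub> k) \<longrightarrow> (\<exists>a'\<in>A. a = a' [^]\<^bsub>B\<^esub> k))"

definition pure_embedding :: "'a monoid \<Rightarrow> 'b monoid \<Rightarrow> ('a \<Rightarrow> 'b) \<Rightarrow> bool" where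
  "pure_embedding A B f \<longleftrightarrow> f \<in> mon A B \<and> pure_subgroup (f ` carrier A) B"

definition direct_summand :: "'a set \<Rightarrow> 'a monoid \<Rightarrow> bool" where
  "direct_summand D G \<longleftrightarrow> subgroup D G \<and>
     (\<exists>K. subgroup K G \<and> D \<inter> K = {\<one>\<^bsub>G\<^esub>} \<and> D <#>\<^bsub>G\<^esub> K = carrier G)"

(* A formula of HOL cannot range over groups of all types, so the test groups G live on the
   type ('a * nat) set, and G contains A via a pure embedding; since a carrier may be any
   subset of the type, G is, up to isomorphism, an arbitrary abelian group of cardinality at
   most 2 ^ max(|'a|, aleph_0).  Larger test groups would not change the notion: every abelian
   group A embeds purely into a direct product of at most |A| * aleph_0 co-cyclic groups.
   That product has cardinality at most 2 ^ (|A| * aleph_0), so it occurs as a test group; if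
   A splits off from it then A, a direct summand of a product of co-cyclic groups, is a direct
   summand of every abelian group containing it as a pure subgroup. *)
definition algebraically_compact :: "'a monoid \<Rightarrow> bool" where
  "algebraically_compact A \<longleftrightarrow>
     (\<forall>(G :: ('a \<times> nat) set monoid) f.
        comm_group G \<longrightarrow> pure_embedding A G f \<longrightarrow> direct_summand (f ` carrier A) G)"

(* Z(p^n) and Z(p^infinity), realised as groups of complex roots of unity so that all of them
   live on one type, as the factors of a product_group have to. *)
definition cocyclic_group :: "nat \<Rightarrow> enat \<Rightarrow> complex monoid" where
  "cocyclic_group p n =
     \<lparr>carrier = (case n of enat m \<Rightarrow> {z. z ^ (p ^ m) = 1} | \<infinity> \<Rightarrow> {z. \<exists>m. z ^ (p ^ m) = 1}),
      monoid.mult = (*), one = 1\<rparr>"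

lemma cocyclic_group_finite:
  assumes "p > 0"
  shows "integer_mod_group (p ^ m) \<cong> cocyclic_group p (enat m)"
proof -
  define N where "N = p ^ m"
  have N: "N > 0" using assms by (simp add: N_def)
  define f where "f = (\<lambda>k::int. cis (2 * pi * real_of_int k / real N))"
  have add: "f (a + b) = f a * f b" for a b
    by (simp add: f_def cis_mult ring_distribs add_divide_distrib)
  have "f (int N * q) = 1" for q
    using N cis_multiple_2pi[of "real_of_int q"] by (simp add: f_def mult.assoc)
  then have mod: "f (a mod int N) = f a" for a
    using add[of "int N * (a div int N)" "a mod int N"] by simp
  have "bij_betw nat {0..<int N} {..<N}"
    by (rule bij_betwI[where g = int]) auto
  from bij_betw_trans[OF this bij_betw_roots_unity[OF N]]
  have "bij_betw f {0..<int N} {z. z ^ N = 1}"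
    by (rule bij_betw_cong[THEN iffD1, rotated]) (auto simp: f_def)
  then have "f \<in> iso (integer_mod_group N) (cocyclic_group p (enat m))"
    using N by (auto simp: iso_def hom_def integer_mod_group_def cocyclic_group_def
        add mod N_def[symmetric] bij_betw_def)
  then show ?thesis
    by (auto simp: is_iso_def N_def)
qed

lemma cocyclic_group_infinite:
  "carrier (cocyclic_group p \<infinity>) = (\<Union>m. carrier (cocyclic_group p (enat m)))"
  by (auto simp: cocyclic_group_def)

(* The cardinal \<mu> is a well-order; the pairs (p, n) with p prime and 1 \<le> n \<le> infinity
   enumerate the isomorphism types of the nontrivial co-cyclic groups without repetition. *)
definition GG :: "'k rel \<Rightarrow> (nat \<times> enat \<times> 'k \<Rightarrow> complex) monoid" where
  "GG \<mu> = product_group {(p, n, i). prime p \<and> 1 \<le> n \<and> i \<in> Field \<mu>}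
            (\<lambda>(p, n, i). cocyclic_group p n)"

(* Every cardinal below \<kappa> is represented on the type of \<kappa>. *)
definition strongly_inaccessible :: "'k rel \<Rightarrow> bool" where
  "strongly_inaccessible \<kappa> \<longleftrightarrow> Card_order \<kappa> \<and> natLeq <o \<kappa> \<and> regularCard \<kappa> \<and>
     (\<forall>\<mu>::'k rel. Card_order \<mu> \<and> \<mu> <o \<kappa> \<longrightarrow> ctwo ^c \<mu> <o \<kappa>)"

definition pure_injective_for :: "'c monoid set \<Rightarrow> 'a monoid \<Rightarrow> bool" where
  "pure_injective_for \<K> A \<longleftrightarrow>
     (\<forall>C\<in>\<K>. \<forall>B. C\<lparr>carrier := B\<rparr> \<in> \<K> \<and> pure_subgroup B C \<longrightarrow>
        (\<forall>f. pure_embedding (C\<lparr>carrier := B\<rparr>) A f \<longrightarrow>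
           (\<exists>g. pure_embedding C A g \<and> (\<forall>x\<in>B. g x = f x))))"

end

(* Since F splits as D plus a complement K, and D absorbs the image of f, one extends f to a
   homomorphism h from C to D by algebraic compactness and adds a pure embedding e of C/B into
   K, which exists because K, being isomorphic to F/D, contains a large enough G_lambda purely.
   The sum h + e is injective and pure: a solution of k x = h(c) + e(c + B) in F first gives
   c + B = k (y + B) by purity of e, and the error term, which lies in f(B), is divisible by k
   in B by purity of f.

   The embedding into G_lambda uses characters: if h is not in k H, a character of H / k H that
   does not vanish at h takes its values in a cyclic p-group annihilated by k, so it witnesses
   that the image of h is not divisible by k.  The case k = 0 gives injectivity. *)
theory Submission
  imports
    Defs
    "HOL-Algebra.Multiplicative_Group"
    "HOL-Algebra.Weak_Morphisms"
    "HOL-Number_Theory.Cong"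
begin

text \<open>Compactness of D yields only a homomorphism h, with no control over its kernel or over
  divisibility outside B. The second summand restores both: e sees C modulo B faithfully and purely,
  while on B the sum is f. In that sum the complement K is represented by a homomorphic section of
  \<open>F Mod D\<close>.

  Algebraic compactness can be tested only on groups carried by the type
  \<open>('a \<times> nat) set\<close>, whereas extending f calls for the pushout of C and D over B,
  which consists of cosets of pairs. Moving it to that type requires an injection of C into the type
  of \<open>F\<close>. Such an injection is obtained from F/D, since G_lambda is large enough to
  receive C itself and not only C/B.

  The characters come from the injectivity of divisible groups: quasi-cyclic groups are divisible,
  so a homomorphism from a cyclic subgroup into one of them extends to the whole group.\<close>

section \<open>Direct products and chains of subgroups\<close>

lemma nat_pow_DirProd:
  "(x, y) [^]\<^bsub>G \<times>\<times> H\<^esub> (n::nat) = (x [^]\<^bsub>G\<^esub> n, y [^]\<^bsub>H\<^esub> n)"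
  by (induction n) auto

lemma int_pow_DirProd:
  assumes "group G" "group H" "x \<in> carrier G" "y \<in> carrier H"
  shows "(x, y) [^]\<^bsub>G \<times>\<times> H\<^esub> (k::int) = (x [^]\<^bsub>G\<^esub> k, y [^]\<^bsub>H\<^esub> k)"
proof -
  interpret G: group G by fact
  interpret H: group H by fact
  interpret GH: group "G \<times>\<times> H" by (rule DirProd_group) fact+
  show ?thesis
    using assms
    by (cases k rule: int_cases2)
      (auto simp: nat_pow_DirProd int_pow_int G.int_pow_neg_int H.int_pow_neg_int GH.int_pow_neg_int)
qed

lemma DirProd_comm_group:
  assumes "comm_group G" "comm_group H"
  shows "comm_group (G \<times>\<times> H)"
proof -
  interpret G: comm_group G by fact
  interpret H: comm_group H by fact
  show ?thesis
    by (rule group.group_comm_groupI[OF DirProd_group[OF G.is_group H.is_group]])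
      (auto simp: G.m_comm H.m_comm)
qed

lemma (in group) subgroup_Union_chain:
  assumes "\<C> \<noteq> {}" "subset.chain {H. subgroup H G} \<C>"
  shows "subgroup (\<Union>\<C>) G"
proof (rule subgroupI)
  have sub: "subgroup H G" if "H \<in> \<C>" for H
    using assms that by (auto simp: subset.chain_def)
  show "\<Union>\<C> \<subseteq> carrier G" using subgroup.subset[OF sub] by auto
  show "\<Union>\<C> \<noteq> {}" using assms(1) subgroup.one_closed[OF sub] by auto
  show "inv a \<in> \<Union>\<C>" if "a \<in> \<Union>\<C>" for a
    using that subgroup.m_inv_closed[OF sub] by auto
  show "a \<otimes> b \<in> \<Union>\<C>" if "a \<in> \<Union>\<C>" "b \<in> \<Union>\<C>" for a b
  proof -
    from that obtain X Y where XY: "a \<in> X" "b \<in> Y" "X \<in> \<C>" "Y \<in> \<C>" by blast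
    then have "X \<subseteq> Y \<or> Y \<subseteq> X" using assms(2) by (auto simp: subset.chain_def)
    then obtain Z where "Z \<in> \<C>" "a \<in> Z" "b \<in> Z" using XY by blast
    then show ?thesis using subgroup.m_closed[OF sub] by blast
  qed
qed

section \<open>Extending homomorphisms into divisible groups\<close>

context
  fixes H :: "('a, 'm) monoid_scheme" and P :: "('b, 'n) monoid_scheme"
  assumes H: "comm_group H" and P: "comm_group P"
begin

interpretation H: comm_group H by (rule H)
interpretation P: comm_group P by (rule P)
interpretation HP: comm_group "H \<times>\<times> P" by (rule DirProd_comm_group[OF H P])

text \<open>This is the one-element step of the Zorn argument. The exponents \<open>j\<close> for
  which \<open>y [^] j\<close> lies in the domain of \<open>R\<close> form an ideal of the integers;
  a value at \<open>y\<close> has to be compatible with a generator \<open>m\<close> of it, and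
  divisibility supplies an \<open>m\<close>-th root.\<close>

lemma extend_single_valued_relation:
  assumes div: "\<And>z n::nat. z \<in> carrier P \<Longrightarrow> n \<ge> 1 \<Longrightarrow> \<exists>w\<in>carrier P. w [^]\<^bsub>P\<^esub> n = z"
    and R: "subgroup R (H \<times>\<times> P)" and y: "y \<in> carrier H"
  obtains z where "z \<in> carrier P"
    "\<And>j::int. \<exists>w. (y [^]\<^bsub>H\<^esub> j, w) \<in> R \<Longrightarrow> (y, z) [^]\<^bsub>H \<times>\<times> P\<^esub> j \<in> R"
proof -
  have RP: "w \<in> carrier P" "x \<in> carrier H" if "(x, w) \<in> R" for x w
    using subgroup.mem_carrier[OF R that] by auto
  have pow: "r [^]\<^bsub>H \<times>\<times> P\<^esub> (j::int) \<in> R" if "r \<in> R" for r j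
    using HP.subgroup_int_pow_closed[OF R that] .
  define Q where "Q m \<longleftrightarrow> m \<ge> 1 \<and> (\<exists>w. (y [^]\<^bsub>H\<^esub> m, w) \<in> R)" for m :: nat
  show thesis
  proof (cases "\<exists>m. Q m")
    case False
    have "(y, \<one>\<^bsub>P\<^esub>) [^]\<^bsub>H \<times>\<times> P\<^esub> j \<in> R" if "(y [^]\<^bsub>H\<^esub> j, w) \<in> R" for j :: int and w
    proof -
      \<comment> \<open>The domain is closed under inverses, so without positive exponents there are
        no negative ones either, and any value at \<open>y\<close> would do.\<close>
      have "j = 0"
      proof (cases j rule: int_cases2)
        case (nonneg n)
        then have "(y [^]\<^bsub>H\<^esub> n, w) \<in> R" using that by (simp add: int_pow_int)
        then have "n = 0" using False unfolding Q_def by (metis less_one linorder_not_le)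
        then show ?thesis using nonneg by simp
      next
        case (nonpos n)
        then have "(inv\<^bsub>H\<^esub> (y [^]\<^bsub>H\<^esub> n), w) \<in> R"
          using that y by (simp add: H.int_pow_neg_int)
        then have "inv\<^bsub>H \<times>\<times> P\<^esub> (inv\<^bsub>H\<^esub> (y [^]\<^bsub>H\<^esub> n), w) \<in> R" "w \<in> carrier P"
          using subgroup.m_inv_closed[OF R] RP by auto
        then have "(y [^]\<^bsub>H\<^esub> n, inv\<^bsub>P\<^esub> w) \<in> R" using y by simp
        then have "n = 0" using False unfolding Q_def by (metis less_one linorder_not_le)
        then show ?thesis using nonpos by simp
      qed
      then show ?thesis using subgroup.one_closed[OF R] by simp
    qed
    then show thesis using that[of "\<one>\<^bsub>P\<^esub>"] by auto
  next
    case True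
    define m where "m = (LEAST m. Q m)"
    have "Q m" unfolding m_def using True by (rule LeastI_ex)
    then obtain w where m: "m \<ge> 1" and w: "(y [^]\<^bsub>H\<^esub> m, w) \<in> R" by (auto simp: Q_def)
    obtain z where z: "z \<in> carrier P" "z [^]\<^bsub>P\<^esub> m = w"
      using div[of w m] RP[OF w] m by blast
    have yzm: "(y, z) [^]\<^bsub>H \<times>\<times> P\<^esub> int m \<in> R"
      using w z by (simp add: int_pow_int nat_pow_DirProd)
    have "(y, z) [^]\<^bsub>H \<times>\<times> P\<^esub> j \<in> R" if "(y [^]\<^bsub>H\<^esub> j, v) \<in> R" for j :: int and v
    proof -
      \<comment> \<open>Division with remainder: a nonzero remainder would be a positive exponent in
        the domain smaller than the least one, \<open>m\<close>.\<close>
      let ?r = "j mod int m" and ?q = "j div int m"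
      have yz: "(y, z) \<in> carrier (H \<times>\<times> P)" using y z by simp
      have q: "(y, z) [^]\<^bsub>H \<times>\<times> P\<^esub> (int m * ?q) \<in> R"
        using pow[OF yzm, of ?q] HP.int_pow_pow[OF yz, of "int m" ?q] by (simp add: mult.commute)
      obtain u where u: "(y, z) [^]\<^bsub>H \<times>\<times> P\<^esub> (- (int m * ?q)) = (y [^]\<^bsub>H\<^esub> (- (int m * ?q)), u)"
        "(y, z) [^]\<^bsub>H \<times>\<times> P\<^esub> (- (int m * ?q)) \<in> R"
        using subgroup.m_inv_closed[OF R q] y z yz
        by (simp add: HP.int_pow_neg) (simp add: int_pow_DirProd H.int_pow_neg)
      have "(y [^]\<^bsub>H\<^esub> j, v) \<otimes>\<^bsub>H \<times>\<times> P\<^esub> (y [^]\<^bsub>H\<^esub> (- (int m * ?q)), u) \<in> R"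
        using subgroup.m_closed[OF R that] u by metis
      moreover have "j + - (int m * ?q) = ?r"
        by (metis add_uminus_conv_diff minus_mult_div_eq_mod)
      ultimately have "(y [^]\<^bsub>H\<^esub> ?r, v \<otimes>\<^bsub>P\<^esub> u) \<in> R"
        using H.int_pow_mult[OF y, of j "- (int m * ?q)"] by simp
      moreover have r: "?r \<ge> 0" "?r < int m" using m by auto
      ultimately have "(y [^]\<^bsub>H\<^esub> nat ?r, v \<otimes>\<^bsub>P\<^esub> u) \<in> R" by (metis pow_nat)
      moreover have "\<not> Q (nat ?r)"
        using not_less_Least[of "nat ?r" Q] r unfolding m_def by linarith
      ultimately have "?r = 0" using r unfolding Q_def
        by (metis less_one linorder_not_le nat_0_iff order_antisym)
      then have "j = int m * ?q" by (metis add_0_right mult_div_mod_eq)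
      then show ?thesis using q by simp
    qed
    then show thesis using that[of z] z by blast
  qed
qed

text \<open>A partial homomorphism from \<open>H\<close> to \<open>P\<close> is represented by its graph, a subgroup of the product
  meeting the second factor trivially, so that Zorn's lemma applies to inclusion of sets.\<close>

lemma divisible_hom_extension:
  assumes div: "\<And>z n::nat. z \<in> carrier P \<Longrightarrow> n \<ge> 1 \<Longrightarrow> \<exists>w\<in>carrier P. w [^]\<^bsub>P\<^esub> n = z"
    and R: "subgroup R (H \<times>\<times> P)" and single: "\<And>z. (\<one>\<^bsub>H\<^esub>, z) \<in> R \<Longrightarrow> z = \<one>\<^bsub>P\<^esub>"
  shows "\<exists>\<chi>\<in>hom H P. \<forall>(x, z)\<in>R. \<chi> x = z"
proof -
  define \<S> where "\<S> = {S. subgroup S (H \<times>\<times> P) \<and> R \<subseteq> S \<and> (\<forall>z. (\<one>\<^bsub>H\<^esub>, z) \<in> S \<longrightarrow> z = \<one>\<^bsub>P\<^esub>)}"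
  have "\<exists>M\<in>\<S>. \<forall>X\<in>\<S>. M \<subseteq> X \<longrightarrow> X = M"
  proof (rule subset_Zorn_nonempty)
    show "\<S> \<noteq> {}" using R single by (auto simp: \<S>_def)
    show "\<Union>\<C> \<in> \<S>" if "\<C> \<noteq> {}" "subset.chain \<S> \<C>" for \<C>
    proof -
      have "subset.chain {S. subgroup S (H \<times>\<times> P)} \<C>"
        using that(2) unfolding subset.chain_def \<S>_def by auto
      then have "subgroup (\<Union>\<C>) (H \<times>\<times> P)"
        using HP.subgroup_Union_chain that(1) by blast
      then show ?thesis
        using that unfolding \<S>_def subset.chain_def by blast
    qed
  qed
  then obtain M where MS: "M \<in> \<S>" and max: "\<And>X. X \<in> \<S> \<Longrightarrow> M \<subseteq> X \<Longrightarrow> X = M"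
    by auto
  have M: "subgroup M (H \<times>\<times> P)" "R \<subseteq> M"
    and M1: "\<And>z. (\<one>\<^bsub>H\<^esub>, z) \<in> M \<Longrightarrow> z = \<one>\<^bsub>P\<^esub>"
    using MS by (auto simp: \<S>_def)
  have MH: "w \<in> carrier P" "x \<in> carrier H" if "(x, w) \<in> M" for x w
    using subgroup.mem_carrier[OF M(1) that] by auto
  have total: "\<exists>z. (y, z) \<in> M" if y: "y \<in> carrier H" for y
  proof -
    obtain z where z: "z \<in> carrier P"
      and ext: "\<And>j::int. \<exists>w. (y [^]\<^bsub>H\<^esub> j, w) \<in> M \<Longrightarrow> (y, z) [^]\<^bsub>H \<times>\<times> P\<^esub> j \<in> M"
      using extend_single_valued_relation[OF div M(1) y] by metis
    define K where "K = generate (H \<times>\<times> P) {(y, z)}"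
    have yz: "(y, z) \<in> carrier (H \<times>\<times> P)" using y z by simp
    have K: "subgroup K (H \<times>\<times> P)"
      unfolding K_def using yz by (intro HP.generate_is_subgroup) auto
    have Kpow: "K = {(y, z) [^]\<^bsub>H \<times>\<times> P\<^esub> (j::int) | j. True}"
      unfolding K_def using HP.generate_pow[OF yz] by simp
    let ?M = "M <#>\<^bsub>H \<times>\<times> P\<^esub> K"
    have sub: "M \<subseteq> ?M"
    proof
      fix r assume r: "r \<in> M"
      then have "r = r \<otimes>\<^bsub>H \<times>\<times> P\<^esub> \<one>\<^bsub>H \<times>\<times> P\<^esub>"
        using subgroup.mem_carrier[OF M(1)] by (metis HP.r_one)
      then show "r \<in> ?M" using r subgroup.one_closed[OF K] unfolding set_mult_def by blast
    qed
    \<comment> \<open>The choice of \<open>z\<close> pays off here: if the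
      \<open>H\<close>-components of \<open>r\<close> in \<open>M\<close> and of a power of
      \<open>(y, z)\<close> cancel, that power already lies in \<open>M\<close>, so the enlarged
      relation is still single-valued.\<close>
    have "u = \<one>\<^bsub>P\<^esub>" if u: "(\<one>\<^bsub>H\<^esub>, u) \<in> ?M" for u
    proof -
      from u obtain r j where r: "r \<in> M" and j: "(\<one>\<^bsub>H\<^esub>, u) = r \<otimes>\<^bsub>H \<times>\<times> P\<^esub> ((y, z) [^]\<^bsub>H \<times>\<times> P\<^esub> (j::int))"
        unfolding set_mult_def Kpow by blast
      obtain a b where ab: "r = (a, b)" by fastforce
      have c: "a \<in> carrier H" "b \<in> carrier P" using MH r ab by auto
      have "a \<otimes>\<^bsub>H\<^esub> y [^]\<^bsub>H\<^esub> j = \<one>\<^bsub>H\<^esub>"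
        using j y z ab by (simp add: int_pow_DirProd)
      then have "inv\<^bsub>H\<^esub> a = y [^]\<^bsub>H\<^esub> j" using c y
        by (metis H.int_pow_closed H.inv_equality H.m_comm)
      moreover have "inv\<^bsub>H \<times>\<times> P\<^esub> r \<in> M" using subgroup.m_inv_closed[OF M(1) r] .
      ultimately have "(y [^]\<^bsub>H\<^esub> j, inv\<^bsub>P\<^esub> b) \<in> M" using c ab by simp
      then have "(y, z) [^]\<^bsub>H \<times>\<times> P\<^esub> j \<in> M" using ext by blast
      then show ?thesis using subgroup.m_closed[OF M(1) r] j M1 by metis
    qed
    then have "?M \<in> \<S>"
      unfolding \<S>_def using HP.mult_subgroups[OF M(1) K] sub M(2) by auto
    then have "?M = M" using max sub by blast
    moreover have "(y, z) \<in> ?M"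
    proof -
      have "(y, z) \<in> K" unfolding K_def by (simp add: generate.incl)
      moreover have "(y, z) = \<one>\<^bsub>H \<times>\<times> P\<^esub> \<otimes>\<^bsub>H \<times>\<times> P\<^esub> (y, z)" using HP.l_one[OF yz] by metis
      ultimately show ?thesis using subgroup.one_closed[OF M(1)] unfolding set_mult_def by blast
    qed
    ultimately show ?thesis by blast
  qed
  have unique: "z = z'" if "(x, z) \<in> M" "(x, z') \<in> M" for x z z'
  proof -
    have c: "x \<in> carrier H" "z \<in> carrier P" "z' \<in> carrier P" using MH that by auto
    have "(x, z) \<otimes>\<^bsub>H \<times>\<times> P\<^esub> inv\<^bsub>H \<times>\<times> P\<^esub> (x, z') \<in> M"
      using that subgroup.m_closed[OF M(1)] subgroup.m_inv_closed[OF M(1)] by metis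
    then have "(\<one>\<^bsub>H\<^esub>, z \<otimes>\<^bsub>P\<^esub> inv\<^bsub>P\<^esub> z') \<in> M" using c by simp
    then show ?thesis using M1 c by (metis P.inv_closed P.inv_equality P.inv_inv)
  qed
  define \<chi> where "\<chi> x = (THE z. (x, z) \<in> M)" for x
  have \<chi>: "\<chi> x = z" if "(x, z) \<in> M" for x z
    unfolding \<chi>_def using that unique by blast
  have "\<chi> \<in> hom H P"
  proof (rule homI)
    fix x assume "x \<in> carrier H"
    then show "\<chi> x \<in> carrier P" using total \<chi> MH by metis
  next
    fix x y assume "x \<in> carrier H" "y \<in> carrier H"
    then obtain u v where "(x, u) \<in> M" "(y, v) \<in> M" using total by blast
    then show "\<chi> (x \<otimes>\<^bsub>H\<^esub> y) = \<chi> x \<otimes>\<^bsub>P\<^esub> \<chi> y"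
      using \<chi> subgroup.m_closed[OF M(1)] by (metis mult_DirProd)
  qed
  then show ?thesis using \<chi> M(2) by blast
qed

text \<open>The order condition makes the subgroup generated by \<open>(x, z)\<close> the graph of a
  homomorphism on the cyclic group of \<open>x\<close>. For \<open>x\<close> of infinite order
  \<open>H.ord x\<close> is 0, and the condition holds for every \<open>z\<close>.\<close>

lemma divisible_hom_extension_cyclic:
  assumes div: "\<And>z n::nat. z \<in> carrier P \<Longrightarrow> n \<ge> 1 \<Longrightarrow> \<exists>w\<in>carrier P. w [^]\<^bsub>P\<^esub> n = z"
    and x: "x \<in> carrier H" and z: "z \<in> carrier P" and ord: "z [^]\<^bsub>P\<^esub> H.ord x = \<one>\<^bsub>P\<^esub>"
  shows "\<exists>\<chi>\<in>hom H P. \<chi> x = z"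
proof -
  define R where "R = generate (H \<times>\<times> P) {(x, z)}"
  have xz: "(x, z) \<in> carrier (H \<times>\<times> P)" using x z by simp
  have R: "subgroup R (H \<times>\<times> P)"
    unfolding R_def using xz by (intro HP.generate_is_subgroup) auto
  have "u = \<one>\<^bsub>P\<^esub>" if "(\<one>\<^bsub>H\<^esub>, u) \<in> R" for u
  proof -
    from that obtain j :: int where "(\<one>\<^bsub>H\<^esub>, u) = (x, z) [^]\<^bsub>H \<times>\<times> P\<^esub> j"
      unfolding R_def using HP.generate_pow[OF xz] by auto
    then have j: "\<one>\<^bsub>H\<^esub> = x [^]\<^bsub>H\<^esub> j" "u = z [^]\<^bsub>P\<^esub> j"
      using x z by (auto simp: int_pow_DirProd)
    then have "int (H.ord x) dvd j" using H.int_pow_eq_id x by metis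
    moreover have "P.ord z dvd H.ord x" using ord P.pow_eq_id z by blast
    ultimately have "int (P.ord z) dvd j" by (meson dvd_trans int_dvd_int_iff)
    then show ?thesis using j P.int_pow_eq_id z by blast
  qed
  from divisible_hom_extension[OF div R this]
  obtain \<chi> where "\<chi> \<in> hom H P" "\<forall>(x, z)\<in>R. \<chi> x = z" by blast
  moreover have "(x, z) \<in> R" unfolding R_def by (simp add: generate.incl)
  ultimately show ?thesis by (auto dest: bspec)
qed

end

section \<open>Co-cyclic groups as groups of roots of unity\<close>

lemma cocyclic_group_simps [simp]:
  "x \<otimes>\<^bsub>cocyclic_group p n\<^esub> y = x * y" "\<one>\<^bsub>cocyclic_group p n\<^esub> = 1"
  by (simp_all add: cocyclic_group_def)

lemma carrier_cocyclic_enat: "z \<in> carrier (cocyclic_group p (enat m)) \<longleftrightarrow> z ^ (p ^ m) = 1"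
  by (simp add: cocyclic_group_def)

lemma carrier_cocyclic_infinity: "z \<in> carrier (cocyclic_group p \<infinity>) \<longleftrightarrow> (\<exists>m. z ^ (p ^ m) = 1)"
  by (simp add: cocyclic_group_def)

lemma power_eq_one_mono:
  fixes z :: "'a::monoid_mult"
  assumes "z ^ a = 1" "a dvd b" shows "z ^ b = 1"
  using assms by (auto simp: dvd_def power_mult)

lemma power_cong_exponent:
  fixes z :: "'a::monoid_mult"
  assumes "z ^ N = 1" "[k = l] (mod N)" shows "z ^ k = z ^ l"
proof -
  have "z ^ j = z ^ (j mod N)" for j
  proof -
    have "z ^ j = z ^ (N * (j div N) + j mod N)" by simp
    also have "\<dots> = z ^ (j mod N)"
      unfolding power_add power_mult assms(1) by simp
    finally show ?thesis .
  qed
  then show ?thesis using assms(2) by (metis cong_def)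
qed

lemma cocyclic_group_comm_group:
  assumes "p > 0" shows "comm_group (cocyclic_group p n)"
proof (rule comm_groupI)
  fix x y assume "x \<in> carrier (cocyclic_group p n)" "y \<in> carrier (cocyclic_group p n)"
  then show "x \<otimes>\<^bsub>cocyclic_group p n\<^esub> y \<in> carrier (cocyclic_group p n)"
  proof (cases n)
    case infinity
    assume "x \<in> carrier (cocyclic_group p n)" "y \<in> carrier (cocyclic_group p n)"
    then obtain a b where "x ^ (p ^ a) = 1" "y ^ (p ^ b) = 1"
      using infinity by (auto simp: carrier_cocyclic_infinity)
    then have "x ^ (p ^ (a + b)) = 1" "y ^ (p ^ (a + b)) = 1"
      by (auto intro: power_eq_one_mono simp: le_imp_power_dvd)
    then have "(x * y) ^ (p ^ (a + b)) = 1" by (simp add: power_mult_distrib)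
    then show ?thesis
      using infinity by (auto simp: carrier_cocyclic_infinity)
  qed (auto simp: carrier_cocyclic_enat power_mult_distrib)
next
  fix x assume x: "x \<in> carrier (cocyclic_group p n)"
  have "inverse x \<in> carrier (cocyclic_group p n)"
    using x by (cases n) (auto simp: carrier_cocyclic_enat carrier_cocyclic_infinity power_inverse)
  \<comment> \<open>Positivity of \<open>p\<close> keeps the number 0 out of the carrier, so that
    the inverse in the field is the inverse in the group.\<close>
  moreover have "x \<noteq> 0"
    using x assms by (cases n) (auto simp: carrier_cocyclic_enat carrier_cocyclic_infinity power_0_left)
  ultimately show "\<exists>y\<in>carrier (cocyclic_group p n). y \<otimes>\<^bsub>cocyclic_group p n\<^esub> x = \<one>\<^bsub>cocyclic_group p n\<^esub>"
    by (intro bexI[of _ "inverse x"]) auto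
qed (cases n; auto simp: carrier_cocyclic_enat carrier_cocyclic_infinity)+

lemma cocyclic_group_pow: "x [^]\<^bsub>cocyclic_group p n\<^esub> (k::nat) = x ^ k"
  by (induction k) (auto simp: mult.commute)

text \<open>Write \<open>n = p ^ a * q\<close> with \<open>q\<close> prime to \<open>p\<close>. A
  complex \<open>p ^ a\<close>-th root of \<open>z\<close> again has \<open>p\<close>-power order,
  and \<open>q\<close> is invertible modulo that order, so the \<open>q\<close>-th root is itself a
  power.\<close>

lemma cocyclic_group_infinity_divisible:
  assumes p: "prime p" and z: "z \<in> carrier (cocyclic_group p \<infinity>)" and n: "(n::nat) \<ge> 1"
  shows "\<exists>w\<in>carrier (cocyclic_group p \<infinity>). w [^]\<^bsub>cocyclic_group p \<infinity>\<^esub> n = z"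
proof -
  obtain m where m: "z ^ (p ^ m) = 1" using z by (auto simp: carrier_cocyclic_infinity)
  obtain a q where q: "n = p ^ a * q" "\<not> p dvd q"
    using n p by (metis multiplicity_decompose' not_one_le_zero not_prime_unit)
  have "z \<noteq> 0" using m p by (auto simp: power_0_left prime_gt_0_nat)
  then have "card {v. v ^ (p ^ a) = z} > 0"
    using p by (subst card_nth_roots) (auto simp: prime_gt_0_nat)
  then obtain v where v: "v ^ (p ^ a) = z"
    by (metis (mono_tags, lifting) card_gt_0_iff ex_in_conv mem_Collect_eq)
  have vm: "v ^ (p ^ (a + m)) = 1" using v m by (simp add: power_add power_mult)
  have "coprime q (p ^ (a + m))"
    using q p by (metis coprime_commute coprime_power_right_iff prime_imp_coprime)
  then obtain u where u: "[q * u = 1] (mod p ^ (a + m))"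
    using cong_solve_coprime_nat by (metis One_nat_def)
  then have "[q * u = 1] (mod p ^ m)"
    by (rule cong_dvd_modulus_nat) (simp add: le_imp_power_dvd)
  then have "z ^ (q * u) = z"
    using power_cong_exponent[OF m] by fastforce
  then have "(v ^ u) ^ n = z"
    unfolding q v[symmetric] by (simp flip: power_mult add: mult.assoc mult.commute mult.left_commute)
  moreover have "(v ^ u) ^ (p ^ (a + m)) = 1"
    by (metis vm power_mult mult.commute power_one)
  ultimately show ?thesis
    by (metis cocyclic_group_pow carrier_cocyclic_infinity)
qed

section \<open>Characters detecting non-divisibility\<close>

text \<open>For a prime \<open>p\<close> dividing the order of \<open>x\<close>, a primitive
  \<open>p\<close>-th root of unity is an admissible value at \<open>x\<close>. Infinite order is
  covered too: it is recorded as 0, which every prime divides.\<close>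

lemma separating_character:
  assumes H: "comm_group H" and x: "x \<in> carrier H" "x \<noteq> \<one>\<^bsub>H\<^esub>"
  obtains p \<chi> where "prime p" "\<chi> \<in> hom H (cocyclic_group p \<infinity>)" "\<chi> x \<noteq> 1"
proof -
  interpret H: comm_group H by fact
  have "H.ord x \<noteq> 1" using x H.ord_eq_1 by blast
  then obtain p where p: "prime p" "p dvd H.ord x" using prime_factor_nat by blast
  define \<zeta> where "\<zeta> = cis (2 * pi / real p)"
  have p2: "p \<ge> 2" using p prime_ge_2_nat by blast
  have \<zeta>p: "\<zeta> ^ p = 1" using p2 by (simp add: \<zeta>_def DeMoivre)
  have "\<zeta> \<noteq> 1"
    using bij_betw_roots_unity[of p] p2
    by (auto simp: \<zeta>_def bij_betw_def dest!: inj_onD[where x = 1 and y = 0])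
  moreover have "\<exists>\<chi>\<in>hom H (cocyclic_group p \<infinity>). \<chi> x = \<zeta>"
  proof (rule divisible_hom_extension_cyclic[OF H cocyclic_group_comm_group])
    show "p > 0" using p2 by simp
    show "\<zeta> \<in> carrier (cocyclic_group p \<infinity>)"
      using \<zeta>p by (auto simp: carrier_cocyclic_infinity intro!: exI[of _ 1])
    show "\<zeta> [^]\<^bsub>cocyclic_group p \<infinity>\<^esub> H.ord x = \<one>\<^bsub>cocyclic_group p \<infinity>\<^esub>"
      using power_eq_one_mono[OF \<zeta>p p(2)] by (simp add: cocyclic_group_pow)
  qed (use x p cocyclic_group_infinity_divisible in auto)
  ultimately show thesis using that p by blast
qed

lemma (in comm_group) nat_powers_subgroup: "subgroup {x [^] (k::nat) | x. x \<in> carrier G} G"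
proof (rule subgroupI)
  show "inv a \<in> {x [^] k | x. x \<in> carrier G}" if "a \<in> {x [^] k | x. x \<in> carrier G}" for a
  proof -
    from that obtain x where "x \<in> carrier G" "a = x [^] k" by auto
    then have "inv a = (inv x) [^] k" "inv x \<in> carrier G" by (simp_all add: nat_pow_inv)
    then show ?thesis by blast
  qed
  show "a \<otimes> b \<in> {x [^] k | x. x \<in> carrier G}"
    if "a \<in> {x [^] k | x. x \<in> carrier G}" "b \<in> {x [^] k | x. x \<in> carrier G}" for a b
    using that by (auto simp flip: nat_pow_distrib)
qed auto

text \<open>On elements of \<open>p\<close>-power order, raising to an exponent prime to
  \<open>p\<close> is injective. Hence a value killed by \<open>k\<close> is already killed by the
  \<open>p\<close>-part of \<open>k\<close>.\<close>

lemma hom_into_cocyclic_bounded: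
  assumes p: "prime p" and \<chi>: "\<chi> \<in> hom H (cocyclic_group p \<infinity>)" and k: "k \<ge> 1"
    and bounded: "\<And>y. y \<in> carrier H \<Longrightarrow> \<chi> y ^ k = 1"
  shows "\<chi> \<in> hom H (cocyclic_group p (enat (multiplicity p k)))"
proof -
  let ?a = "multiplicity p k"
  have "\<chi> y ^ (p ^ ?a) = 1" if y: "y \<in> carrier H" for y
  proof -
    obtain m where m: "\<chi> y ^ (p ^ m) = 1"
      using \<chi> y by (auto simp: hom_def Pi_def carrier_cocyclic_infinity)
    obtain q where q: "k = p ^ ?a * q" "\<not> p dvd q"
      using k p by (metis multiplicity_decompose' not_one_le_zero not_prime_unit)
    have "coprime q (p ^ m)"
      using q p by (metis coprime_commute coprime_power_right_iff prime_imp_coprime)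
    then obtain u where "[q * u = 1] (mod p ^ m)"
      using cong_solve_coprime_nat by (metis One_nat_def)
    let ?w = "\<chi> y ^ (p ^ ?a)"
    have w: "?w ^ (p ^ m) = 1" using m by (metis power_mult mult.commute power_one)
    have "?w ^ (q * u) = 1"
      using bounded[OF y] q(1) by (metis power_mult power_one)
    then show ?thesis
      using power_cong_exponent[OF w \<open>[q * u = 1] (mod p ^ m)\<close>] by simp
  qed
  then show ?thesis using \<chi> by (auto simp: hom_def Pi_def carrier_cocyclic_enat)
qed

text \<open>Leaving the quasi-cyclic group matters for \<open>k \<ge> 1\<close>: it is divisible, so
  there every value is a \<open>k\<close>-th power. In a factor annihilated by \<open>k\<close>, the
  value at \<open>h\<close> is not one because it is nontrivial.\<close>

lemma nonpower_character:
  fixes k :: nat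
  assumes H: "comm_group H" and h: "h \<in> carrier H"
    and nonpower: "\<And>x. x \<in> carrier H \<Longrightarrow> h \<noteq> x [^]\<^bsub>H\<^esub> k"
  shows "\<exists>p n \<chi>. prime p \<and> 1 \<le> n \<and> \<chi> \<in> hom H (cocyclic_group p n) \<and> \<chi> h \<noteq> 1 \<and>
    (\<forall>y\<in>carrier (cocyclic_group p n). y ^ k = 1)"
proof -
  interpret H: comm_group H by fact
  define N where "N = {x [^]\<^bsub>H\<^esub> k | x. x \<in> carrier H}"
  have N: "subgroup N H" unfolding N_def by (rule H.nat_powers_subgroup)
  interpret N: normal N H using N H.normal_iff_subgroup by blast
  have "h \<in> N #>\<^bsub>H\<^esub> h" using N h H.rcos_self by blast
  moreover have "h \<notin> N" using nonpower unfolding N_def by blast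
  ultimately have "N #>\<^bsub>H\<^esub> h \<noteq> \<one>\<^bsub>H Mod N\<^esub>" by auto
  moreover have "N #>\<^bsub>H\<^esub> h \<in> carrier (H Mod N)" using h by (auto simp: carrier_FactGroup)
  ultimately obtain p \<chi>' where p: "prime p" and \<chi>': "\<chi>' \<in> hom (H Mod N) (cocyclic_group p \<infinity>)"
    and h': "\<chi>' (N #>\<^bsub>H\<^esub> h) \<noteq> 1"
    using separating_character[OF H.abelian_FactGroup[OF N]] by metis
  define \<chi> where "\<chi> = \<chi>' \<circ> (\<lambda>x. N #>\<^bsub>H\<^esub> x)"
  interpret P: comm_group "cocyclic_group p \<infinity>"
    using p by (intro cocyclic_group_comm_group) (simp add: prime_gt_0_nat)
  have \<chi>: "\<chi> \<in> hom H (cocyclic_group p \<infinity>)"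
    unfolding \<chi>_def using N.r_coset_hom_Mod \<chi>' by (rule hom_compose)
  have bounded: "\<chi> y ^ k = 1" if y: "y \<in> carrier H" for y
  proof -
    have "\<chi> y ^ k = \<chi> (y [^]\<^bsub>H\<^esub> k)"
      using hom_nat_pow[OF \<chi> y H.is_group P.is_group] by (simp add: cocyclic_group_pow)
    also have "y [^]\<^bsub>H\<^esub> k \<in> N" unfolding N_def using y by blast
    then have "N #>\<^bsub>H\<^esub> (y [^]\<^bsub>H\<^esub> k) = N" using y N H.coset_join2 by simp
    then have "\<chi> (y [^]\<^bsub>H\<^esub> k) = \<chi>' \<one>\<^bsub>H Mod N\<^esub>" by (simp add: \<chi>_def)
    also have "\<dots> = 1"
      using hom_one[OF \<chi>' N.factorgroup_is_group P.is_group] by simp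
    finally show ?thesis .
  qed
  have \<chi>h: "\<chi> h \<noteq> 1" using h' by (simp add: \<chi>_def)
  show ?thesis
  proof (cases "k = 0")
    \<comment> \<open>For \<open>k = 0\<close> the bound on the factor reads
      \<open>y ^ 0 = 1\<close>, so the whole quasi-cyclic group is admissible.\<close>
    case True
    then show ?thesis using p \<chi> \<chi>h by (intro exI[of _ p] exI[of _ \<infinity>] exI[of _ \<chi>]) auto
  next
    case False
    let ?a = "multiplicity p k"
    have hom: "\<chi> \<in> hom H (cocyclic_group p (enat ?a))"
      using hom_into_cocyclic_bounded[OF p \<chi> _ bounded] False by simp
    have "\<chi> h ^ (p ^ ?a) = 1"
      using hom h by (auto simp: hom_def Pi_def carrier_cocyclic_enat)
    \<comment> \<open>The trivial group is not among the factors of \<open>GG\<close>; the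
      nontrivial value at \<open>h\<close> rules it out.\<close>
    then have "?a \<noteq> 0" using \<chi>h by (metis power_0 power_one_right)
    then have "1 \<le> enat ?a" by (simp add: one_enat_def Suc_le_eq)
    moreover have "y ^ k = 1" if "y \<in> carrier (cocyclic_group p (enat ?a))" for y
      using that by (metis carrier_cocyclic_enat power_eq_one_mono multiplicity_dvd)
    ultimately show ?thesis using p hom \<chi>h by blast
  qed
qed

section \<open>Calculus of pure embeddings\<close>

lemma pure_embeddingI:
  assumes "group A" "group B" "f \<in> hom A B" "inj_on f (carrier A)"
    and "\<And>a b (k::nat). \<lbrakk>a \<in> carrier A; b \<in> carrier B; k \<ge> 1; f a = b [^]\<^bsub>B\<^esub> k\<rbrakk>
      \<Longrightarrow> \<exists>a'\<in>carrier A. a = a' [^]\<^bsub>A\<^esub> k"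
  shows "pure_embedding A B f"
proof -
  interpret f: group_hom A B f
    using assms by (simp add: group_hom_def group_hom_axioms_def)
  have "\<exists>a'\<in>f ` carrier A. f a = a' [^]\<^bsub>B\<^esub> k"
    if "a \<in> carrier A" "b \<in> carrier B" "k \<ge> 1" "f a = b [^]\<^bsub>B\<^esub> k" for a b and k :: nat
    using assms(5)[OF that] f.hom_nat_pow by blast
  then show ?thesis
    using assms f.img_is_subgroup by (auto simp: pure_embedding_def pure_subgroup_def mon_def)
qed

lemma pure_embedding_hom: "pure_embedding A B f \<Longrightarrow> f \<in> hom A B"
  and pure_embedding_inj: "pure_embedding A B f \<Longrightarrow> inj_on f (carrier A)"
  by (simp_all add: pure_embedding_def mon_def)

text \<open>Purity provides a root only inside the image; injectivity pulls it back to
  \<open>A\<close>.\<close>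

lemma pure_embedding_root:
  fixes k :: nat
  assumes f: "pure_embedding A B f" and "group A" "group B"
    and a: "a \<in> carrier A" "b \<in> carrier B" "k \<ge> 1" "f a = b [^]\<^bsub>B\<^esub> k"
  shows "\<exists>a'\<in>carrier A. a = a' [^]\<^bsub>A\<^esub> k"
proof -
  interpret f: group_hom A B f
    using assms pure_embedding_hom by (simp add: group_hom_def group_hom_axioms_def)
  obtain a' where a': "a' \<in> carrier A" "f a = f a' [^]\<^bsub>B\<^esub> k"
    using f a unfolding pure_embedding_def pure_subgroup_def by blast
  then have "f a = f (a' [^]\<^bsub>A\<^esub> k)" using f.hom_nat_pow by simp
  then show ?thesis
    using pure_embedding_inj[OF f] a a' by (metis f.G.nat_pow_closed inj_onD)
qed

lemma pure_embedding_comp: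
  assumes "group A" "group B" "group C" "pure_embedding A B f" "pure_embedding B C g"
  shows "pure_embedding A C (g \<circ> f)"
proof (rule pure_embeddingI)
  have f: "f \<in> hom A B" "inj_on f (carrier A)" and g: "g \<in> hom B C" "inj_on g (carrier B)"
    using assms pure_embedding_hom pure_embedding_inj by blast+
  show "g \<circ> f \<in> hom A C" using f g hom_compose by blast
  have "f ` carrier A \<subseteq> carrier B" using f by (auto simp: hom_def)
  then show "inj_on (g \<circ> f) (carrier A)" using f g by (meson comp_inj_on inj_on_subset)
  show "\<exists>a'\<in>carrier A. a = a' [^]\<^bsub>A\<^esub> k"
    if a: "a \<in> carrier A" "c \<in> carrier C" "1 \<le> k" "(g \<circ> f) a = c [^]\<^bsub>C\<^esub> k" for a c and k :: nat
  proof -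
    have "f a \<in> carrier B" using f a by (auto simp: hom_def)
    then obtain b where "b \<in> carrier B" "f a = b [^]\<^bsub>B\<^esub> k"
      using pure_embedding_root[OF assms(5) assms(2,3), of "f a" c k] a by auto
    then show ?thesis using pure_embedding_root[OF assms(4) assms(1,2)] a by blast
  qed
qed fact+

lemma iso_imp_pure_embedding:
  assumes "group A" "group B" "f \<in> iso A B"
  shows "pure_embedding A B f"
proof -
  interpret A: group A by fact
  have f: "f \<in> hom A B" "inj_on f (carrier A)" "f ` carrier A = carrier B"
    using assms(3) by (auto simp: iso_def bij_betw_def)
  have "\<exists>a'\<in>carrier A. a = a' [^]\<^bsub>A\<^esub> k"
    if a: "a \<in> carrier A" "b \<in> carrier B" "f a = b [^]\<^bsub>B\<^esub> k" for a b and k :: nat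
  proof -
    obtain a' where a': "a' \<in> carrier A" "b = f a'" using a f by blast
    then have "f a = f (a' [^]\<^bsub>A\<^esub> k)"
      using a hom_nat_pow[OF f(1) _ assms(1,2)] by simp
    then show ?thesis using f(2) a a' by (metis A.nat_pow_closed inj_onD)
  qed
  then show ?thesis using pure_embeddingI[OF assms(1,2) f(1,2)] by blast
qed

lemma pure_subgroup_inclusion:
  assumes "group G" "pure_subgroup P G"
  shows "pure_embedding (G\<lparr>carrier := P\<rparr>) G id"
  using assms subgroup.subset[of P G] by (auto simp: pure_embedding_def pure_subgroup_def mon_def hom_def)

section \<open>Pure embeddings into products of co-cyclic groups\<close>

lemma GG_group: "group (GG \<mu>)"
  unfolding GG_def
  by (rule product_group) (auto intro!: comm_group.axioms(2) cocyclic_group_comm_group prime_gt_0_nat)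

text \<open>One coordinate is spent on each pair of an element and an exponent \<open>k\<close> for which the element
  is not a \<open>k\<close>-th power; the pairs with \<open>k = 0\<close> make the map injective.\<close>

lemma pure_embedding_into_GG:
  assumes H: "comm_group H" and card: "|carrier H| \<le>o |Field \<mu>|" and inf: "infinite (Field \<mu>)"
  shows "\<exists>e. pure_embedding H (GG \<mu>) e"
proof -
  interpret H: comm_group H by fact
  define S where "S = {(h, k::nat). h \<in> carrier H \<and> (\<forall>x\<in>carrier H. h \<noteq> x [^]\<^bsub>H\<^esub> k)}"
  define I where "I = {(p::nat, n::enat, i). prime p \<and> 1 \<le> n \<and> i \<in> Field \<mu>}"
  \<comment> \<open>Pairing with countably many exponents does not exceed an infinite cardinal, so
    the copies of each factor suffice to give every pair in \<open>S\<close> its own index.\<close>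
  have "|carrier H \<times> (UNIV :: nat set)| \<le>o |Field \<mu>|"
    using card inf by (intro card_of_Times_ordLeq_infinite_Field)
      (auto simp: Field_card_of card_of_card_order_on infinite_iff_card_of_nat)
  moreover have "|S| \<le>o |carrier H \<times> (UNIV :: nat set)|"
    by (rule card_of_mono1) (auto simp: S_def)
  ultimately have "|S| \<le>o |Field \<mu>|" using ordLeq_transitive by blast
  then obtain idx where idx: "inj_on idx S" "idx ` S \<subseteq> Field \<mu>"
    using card_of_ordLeq[of S "Field \<mu>"] by blast
  have "\<forall>s\<in>S. \<exists>p n \<chi>. prime p \<and> 1 \<le> n \<and> \<chi> \<in> hom H (cocyclic_group p n) \<and> \<chi> (fst s) \<noteq> 1 \<and>
    (\<forall>y\<in>carrier (cocyclic_group p n). y ^ snd s = 1)"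
    using nonpower_character[OF H] by (auto simp: S_def)
  then obtain p n \<chi> where c: "\<And>s. s \<in> S \<Longrightarrow> prime (p s) \<and> 1 \<le> n s \<and>
      \<chi> s \<in> hom H (cocyclic_group (p s) (n s)) \<and> \<chi> s (fst s) \<noteq> 1 \<and>
      (\<forall>y\<in>carrier (cocyclic_group (p s) (n s)). y ^ snd s = 1)"
    by metis
  \<comment> \<open>The pair \<open>s\<close> occupies only the factor of its own isomorphism type
    with index \<open>idx s\<close>; all remaining factors receive the trivial character.\<close>
  define coord where "coord = (\<lambda>(q, m, i) x.
    let s = inv_into S idx i in if i \<in> idx ` S \<and> p s = q \<and> n s = m then \<chi> s x else 1)"
  have coord_hom: "coord (q, m, i) \<in> hom H (cocyclic_group q m)" if "prime q" for q m i
  proof -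
    interpret Q: comm_group "cocyclic_group q m"
      using that by (intro cocyclic_group_comm_group) (simp add: prime_gt_0_nat)
    show ?thesis
    proof (cases "i \<in> idx ` S \<and> p (inv_into S idx i) = q \<and> n (inv_into S idx i) = m")
      case True
      then have "coord (q, m, i) = \<chi> (inv_into S idx i)" by (auto simp: coord_def Let_def)
      then show ?thesis using True c by (metis inv_into_into)
    next
      case False
      then have "coord (q, m, i) = (\<lambda>_. 1)" by (auto simp: coord_def Let_def)
      then show ?thesis using Q.one_closed by (auto simp: hom_def)
    qed
  qed
  define e where "e x = (\<lambda>t\<in>I. coord t x)" for x
  have GG: "GG \<mu> = product_group I (\<lambda>(p, n, i). cocyclic_group p n)"
    by (simp add: GG_def I_def)
  interpret GG: group "GG \<mu>" by (rule GG_group)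
  have e: "e \<in> hom H (GG \<mu>)"
  proof (rule homI)
    show "e x \<in> carrier (GG \<mu>)" if "x \<in> carrier H" for x
      using coord_hom that by (auto simp: GG e_def I_def hom_def Pi_def)
    show "e (x \<otimes>\<^bsub>H\<^esub> y) = e x \<otimes>\<^bsub>GG \<mu>\<^esub> e y" if "x \<in> carrier H" "y \<in> carrier H" for x y
    proof -
      have "coord t (x \<otimes>\<^bsub>H\<^esub> y) = coord t x * coord t y" if "t \<in> I" for t
        using coord_hom \<open>x \<in> carrier H\<close> \<open>y \<in> carrier H\<close> that
        by (cases t) (auto simp: I_def hom_def)
      then show ?thesis by (auto simp: GG e_def fun_eq_iff split: prod.splits)
    qed
  qed
  have root: "\<exists>x\<in>carrier H. h = x [^]\<^bsub>H\<^esub> k"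
    if h: "h \<in> carrier H" and y: "y \<in> carrier (GG \<mu>)" and eq: "e h = y [^]\<^bsub>GG \<mu>\<^esub> k" for h y and k :: nat
  proof (rule ccontr)
    assume "\<not> ?thesis"
    then have s: "(h, k) \<in> S" using h by (auto simp: S_def)
    let ?t = "(p (h, k), n (h, k), idx (h, k))"
    have t: "?t \<in> I" using s c idx by (auto simp: I_def)
    have "(y [^]\<^bsub>GG \<mu>\<^esub> j) ?t = y ?t ^ j" for j :: nat
      using t by (induction j) (auto simp: GG mult.commute)
    moreover have "y ?t ^ k = 1"
    proof -
      have "y ?t \<in> carrier (cocyclic_group (p (h, k)) (n (h, k)))"
        using y t by (auto simp: GG PiE_def Pi_def)
      then show ?thesis using c[OF s] by auto
    qed
    moreover have "e h ?t = \<chi> (h, k) h"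
      using t s idx by (simp add: e_def coord_def Let_def)
    ultimately show False using eq c[OF s] by auto
  qed
  have "inj_on e (carrier H)"
  proof -
    interpret e: group_hom H "GG \<mu>" e
      using e by (simp add: group_hom_def group_hom_axioms_def H.is_group GG.is_group)
    have "h = \<one>\<^bsub>H\<^esub>" if "h \<in> carrier H" "e h = \<one>\<^bsub>GG \<mu>\<^esub>" for h
      \<comment> \<open>The exponent 0 turns the root property into a statement about the kernel: a
        zeroth power is trivial.\<close>
      using root[of h "\<one>\<^bsub>GG \<mu>\<^esub>" 0] that by auto
    then show ?thesis by (simp add: e.inj_on_one_iff)
  qed
  then show ?thesis
    using pure_embeddingI[OF H.is_group GG.is_group e] root by blast
qed

section \<open>Retractions and sections of direct summands\<close>

text \<open>The retraction is the projection along a complement. Both the identity on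
  \<open>D\<close> and multiplicativity follow from the uniqueness of the
  \<open>D\<close>-component.\<close>

lemma direct_summand_retraction:
  assumes G: "comm_group G" and "direct_summand D G"
  shows "\<exists>r\<in>hom G (G\<lparr>carrier := D\<rparr>). \<forall>x\<in>D. r x = x"
proof -
  interpret G: comm_group G by fact
  obtain K where D: "subgroup D G" and K: "subgroup K G" and DK: "D \<inter> K = {\<one>\<^bsub>G\<^esub>}"
    and sum: "D <#>\<^bsub>G\<^esub> K = carrier G"
    using assms(2) by (auto simp: direct_summand_def)
  have unique: "d = d'"
    if "d \<in> D" "d' \<in> D" "k \<in> K" "k' \<in> K" "d \<otimes>\<^bsub>G\<^esub> k = d' \<otimes>\<^bsub>G\<^esub> k'" for d d' k k'
  proof -
    have c: "d \<in> carrier G" "d' \<in> carrier G" "k \<in> carrier G" "k' \<in> carrier G"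
      using that subgroup.mem_carrier D K by metis+
    have "inv\<^bsub>G\<^esub> d' \<otimes>\<^bsub>G\<^esub> d = inv\<^bsub>G\<^esub> d' \<otimes>\<^bsub>G\<^esub> (d \<otimes>\<^bsub>G\<^esub> k) \<otimes>\<^bsub>G\<^esub> inv\<^bsub>G\<^esub> k"
      using c by (simp add: G.m_assoc)
    also have "\<dots> = k' \<otimes>\<^bsub>G\<^esub> inv\<^bsub>G\<^esub> k"
      using c by (simp add: that(5) flip: G.m_assoc)
    finally have "inv\<^bsub>G\<^esub> d' \<otimes>\<^bsub>G\<^esub> d \<in> D \<inter> K"
      using that D K by (metis IntI subgroup.m_closed subgroup.m_inv_closed)
    then have "inv\<^bsub>G\<^esub> d' \<otimes>\<^bsub>G\<^esub> d = \<one>\<^bsub>G\<^esub>" using DK by blast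
    then show ?thesis using c by (metis G.inv_closed G.inv_equality G.inv_inv)
  qed
  have "\<forall>x\<in>carrier G. \<exists>d. d \<in> D \<and> (\<exists>k\<in>K. x = d \<otimes>\<^bsub>G\<^esub> k)"
    using sum unfolding set_mult_def by blast
  then obtain r where r: "\<And>x. x \<in> carrier G \<Longrightarrow> r x \<in> D \<and> (\<exists>k\<in>K. x = r x \<otimes>\<^bsub>G\<^esub> k)"
    by metis
  have "r x = x" if "x \<in> D" for x
  proof -
    have x: "x \<in> carrier G" using that D by (rule subgroup.mem_carrier[rotated])
    then obtain k where "k \<in> K" "x = r x \<otimes>\<^bsub>G\<^esub> k" using r by blast
    then show ?thesis
      using unique[of "r x" x k "\<one>\<^bsub>G\<^esub>"] r[OF x] that x subgroup.one_closed[OF K] by simp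
  qed
  moreover have "r \<in> hom G (G\<lparr>carrier := D\<rparr>)"
  proof (rule homI)
    show "r x \<in> carrier (G\<lparr>carrier := D\<rparr>)" if "x \<in> carrier G" for x using r[OF that] by simp
    fix x y assume x: "x \<in> carrier G" and y: "y \<in> carrier G"
    obtain k l where k: "k \<in> K" "x = r x \<otimes>\<^bsub>G\<^esub> k" and l: "l \<in> K" "y = r y \<otimes>\<^bsub>G\<^esub> l"
      using r x y by metis
    obtain m where m: "m \<in> K" "x \<otimes>\<^bsub>G\<^esub> y = r (x \<otimes>\<^bsub>G\<^esub> y) \<otimes>\<^bsub>G\<^esub> m"
      using r G.m_closed[OF x y] by metis
    have c: "r x \<in> carrier G" "r y \<in> carrier G" "k \<in> carrier G" "l \<in> carrier G"
      using r x y k l subgroup.mem_carrier D K by metis+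
    have "x \<otimes>\<^bsub>G\<^esub> y = (r x \<otimes>\<^bsub>G\<^esub> k) \<otimes>\<^bsub>G\<^esub> (r y \<otimes>\<^bsub>G\<^esub> l)" using k l by metis
    also have "\<dots> = (r x \<otimes>\<^bsub>G\<^esub> r y) \<otimes>\<^bsub>G\<^esub> (k \<otimes>\<^bsub>G\<^esub> l)" using c by (simp add: G.m_ac)
    finally have "r (x \<otimes>\<^bsub>G\<^esub> y) \<otimes>\<^bsub>G\<^esub> m = (r x \<otimes>\<^bsub>G\<^esub> r y) \<otimes>\<^bsub>G\<^esub> (k \<otimes>\<^bsub>G\<^esub> l)" using m by metis
    then have "r (x \<otimes>\<^bsub>G\<^esub> y) = r x \<otimes>\<^bsub>G\<^esub> r y"
      using unique r x y k l m D K by (meson G.m_closed subgroup.m_closed)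
    then show "r (x \<otimes>\<^bsub>G\<^esub> y) = r x \<otimes>\<^bsub>G\<lparr>carrier := D\<rparr>\<^esub> r y" by simp
  qed
  ultimately show ?thesis by blast
qed

lemma (in group) rcos_absorb:
  assumes "subgroup N G" "n \<in> N" "x \<in> carrier G"
  shows "N #> (n \<otimes> x) = N #> x"
proof -
  have "n \<in> carrier G" "N \<subseteq> carrier G" using assms subgroup.subset by auto
  then have "N #> (n \<otimes> x) = (N #> n) #> x" using assms coset_mult_assoc by simp
  then show ?thesis using assms \<open>n \<in> carrier G\<close> coset_join2 by simp
qed

text \<open>With a retraction \<open>r\<close> onto \<open>D\<close>, the map sending
  \<open>x\<close> to \<open>r x\<close> inverse times \<open>x\<close> kills \<open>D\<close> and
  moves each \<open>x\<close> only within its coset, so it factors through the quotient as a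
  section.\<close>

lemma direct_summand_section:
  assumes G: "comm_group G" and D: "direct_summand D G"
  shows "\<exists>s\<in>hom (G Mod D) G. \<forall>X\<in>carrier (G Mod D). D #>\<^bsub>G\<^esub> s X = X"
proof -
  interpret G: comm_group G by fact
  have sub: "subgroup D G" using D by (simp add: direct_summand_def)
  then have "D \<lhd> G" using G.normal_iff_subgroup by blast
  obtain r where r: "r \<in> hom G (G\<lparr>carrier := D\<rparr>)" "\<And>x. x \<in> D \<Longrightarrow> r x = x"
    using direct_summand_retraction[OF assms] by blast
  have rD: "r x \<in> D" if "x \<in> carrier G" for x using r that by (auto simp: hom_def)
  have rG: "r x \<in> carrier G" if "x \<in> carrier G" for x using rD[OF that] sub subgroup.mem_carrier by metis
  define t where "t x = inv\<^bsub>G\<^esub> r x \<otimes>\<^bsub>G\<^esub> x" for x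
  interpret t: group_hom G G t
  proof unfold_locales
    have "t (x \<otimes>\<^bsub>G\<^esub> y) = t x \<otimes>\<^bsub>G\<^esub> t y" if "x \<in> carrier G" "y \<in> carrier G" for x y
      using that rG hom_mult[OF r(1) that] by (simp add: t_def G.inv_mult G.m_ac)
    then show "t \<in> hom G G" using rG by (intro homI) (auto simp: t_def)
  qed
  have "D \<subseteq> kernel G G t"
    using sub subgroup.mem_carrier r(2) by (fastforce simp: kernel_def t_def)
  then obtain s where s: "s \<in> hom (G Mod D) G" "\<And>x. x \<in> carrier G \<Longrightarrow> s (D #>\<^bsub>G\<^esub> x) = t x"
    using t.FactGroup_universal_kernel[OF \<open>D \<lhd> G\<close>] by metis
  have "D #>\<^bsub>G\<^esub> t x = D #>\<^bsub>G\<^esub> x" if "x \<in> carrier G" for x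
    unfolding t_def using G.rcos_absorb[OF sub] rD that subgroup.m_inv_closed[OF sub] by simp
  then have "\<forall>X\<in>carrier (G Mod D). D #>\<^bsub>G\<^esub> s X = X" using s(2) by (simp add: carrier_FactGroup)
  then show ?thesis using s(1) by blast
qed

section \<open>Transport to the type of test groups, and the pushout\<close>

text \<open>Transport of structure: an injective map is a weak morphism relative to the trivial
  subgroup, so \<open>image_group\<close> carries an isomorphic copy of \<open>Q\<close>.\<close>

lemma image_group_iso:
  assumes "comm_group Q" "inj_on \<phi> (carrier Q)"
  shows "comm_group (image_group \<phi> Q)" "\<phi> \<in> iso Q (image_group \<phi> Q)"
proof -
  interpret Q: comm_group Q by fact
  have "weak_group_morphism \<phi> {\<one>\<^bsub>Q\<^esub>} Q"
  proof (rule weak_group_morphismsI)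
    show "{\<one>\<^bsub>Q\<^esub>} \<lhd> Q" using Q.normal_iff_subgroup Q.triv_subgroup by blast
    show "\<phi> a = \<phi> b \<longleftrightarrow> a \<otimes>\<^bsub>Q\<^esub> inv\<^bsub>Q\<^esub> b \<in> {\<one>\<^bsub>Q\<^esub>}" if "a \<in> carrier Q" "b \<in> carrier Q" for a b
      using assms(2) that Q.r_inv by (metis Q.inv_closed Q.inv_equality Q.inv_inv inj_on_eq_iff singleton_iff)
  qed
  then have "group (image_group \<phi> Q)" and hom: "\<phi> \<in> hom Q (image_group \<phi> Q)"
    using Q.image_group_is_group Q.weak_group_morphism_is_hom by blast+
  then show iso: "\<phi> \<in> iso Q (image_group \<phi> Q)"
    using assms(2) by (simp add: iso_def bij_betw_def image_group_carrier)
  then show "comm_group (image_group \<phi> Q)"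
    using Q.iso_imp_comm_group \<open>group (image_group \<phi> Q)\<close> by (metis empty_iff is_iso_def group.is_monoid)
qed

text \<open>Choosing a representative of each coset shows that a quotient fits into any type into
  which the group itself fits.\<close>

lemma (in group) inj_on_rcosets_of_inj_on:
  assumes N: "subgroup N G" and \<psi>: "inj_on \<psi> (carrier G)"
  shows "inj_on (\<lambda>X. \<psi> (SOME x. x \<in> X)) (carrier (G Mod N))"
proof (rule inj_onI)
  have rep: "(SOME x. x \<in> X) \<in> carrier G \<and> N #> (SOME x. x \<in> X) = X" if X: "X \<in> carrier (G Mod N)" for X
  proof -
    obtain y where y: "y \<in> carrier G" "X = N #> y" using X by (auto simp: carrier_FactGroup)
    then have "y \<in> X" using N rcos_self by simp
    then have "(SOME x. x \<in> X) \<in> N #> y" using y by (metis someI)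
    then show ?thesis using y repr_independence[OF _ _ N] r_coset_subset_G N
      by (metis subgroup.subset subsetD)
  qed
  fix X Y assume XY: "X \<in> carrier (G Mod N)" "Y \<in> carrier (G Mod N)"
    "\<psi> (SOME x. x \<in> X) = \<psi> (SOME x. x \<in> Y)"
  then have "(SOME x. x \<in> X) = (SOME x. x \<in> Y)" using \<psi> rep by (meson inj_onD)
  then show "X = Y" using rep XY by metis
qed

text \<open>The pushout of the inclusion of \<open>B\<close> in \<open>C\<close> along \<open>f\<close> contains \<open>A\<close> as a pure subgroup, and \<open>j\<close>
  transports it to the type of the test groups in the definition of algebraic compactness.\<close>

lemma algebraically_compact_extension:
  fixes A :: "'a monoid" and C :: "'c monoid" and j :: "'c \<Rightarrow> 'a"
  assumes A: "comm_group A" "algebraically_compact A" and C: "comm_group C"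
    and B: "pure_subgroup B C" and f: "f \<in> hom (C\<lparr>carrier := B\<rparr>) A" and j: "inj_on j (carrier C)"
  shows "\<exists>h\<in>hom C A. \<forall>x\<in>B. h x = f x"
proof -
  interpret A: comm_group A by fact
  interpret C: comm_group C by fact
  have BC: "subgroup B C" using B by (simp add: pure_subgroup_def)
  have mem: "b \<in> carrier C" if "b \<in> B" for b using BC that by (rule subgroup.mem_carrier)
  have fA: "f b \<in> carrier A" if "b \<in> B" for b using f that by (auto simp: hom_def)
  have f_mult: "f (b \<otimes>\<^bsub>C\<^esub> b') = f b \<otimes>\<^bsub>A\<^esub> f b'" if "b \<in> B" "b' \<in> B" for b b'
    using f that by (auto simp: hom_def)
  interpret f: group_hom "C\<lparr>carrier := B\<rparr>" A f
    using f BC by (simp add: group_hom_def group_hom_axioms_def C.subgroup_imp_group A.is_group)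
  have f_one: "f \<one>\<^bsub>C\<^esub> = \<one>\<^bsub>A\<^esub>" using f.hom_one by simp
  have f_inv: "f (inv\<^bsub>C\<^esub> b) = inv\<^bsub>A\<^esub> f b" if "b \<in> B" for b
    using f.hom_inv[of b] that C.m_inv_consistent[OF BC that] by simp
  have f_pow: "f (b [^]\<^bsub>C\<^esub> k) = f b [^]\<^bsub>A\<^esub> k" if "b \<in> B" for b and k :: nat
    using f.hom_nat_pow[of b k] that C.nat_pow_consistent[of b k B] by simp
  let ?S = "A \<times>\<times> C"
  interpret S: comm_group ?S by (rule DirProd_comm_group) fact+
  \<comment> \<open>Dividing by these pairs identifies \<open>b\<close> in \<open>C\<close> with
    \<open>f b\<close> in \<open>A\<close>.\<close>
  define N where "N = (\<lambda>b. (f b, inv\<^bsub>C\<^esub> b)) ` B"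
  have N: "subgroup N ?S"
  proof (rule S.subgroupI)
    show "N \<subseteq> carrier ?S" using fA mem by (auto simp: N_def)
    show "N \<noteq> {}" using subgroup.one_closed[OF BC] by (auto simp: N_def)
    show "inv\<^bsub>?S\<^esub> a \<in> N" if a: "a \<in> N" for a
    proof -
      obtain b where b: "b \<in> B" "a = (f b, inv\<^bsub>C\<^esub> b)" using a by (auto simp: N_def)
      then have "inv\<^bsub>?S\<^esub> a = (f (inv\<^bsub>C\<^esub> b), inv\<^bsub>C\<^esub> (inv\<^bsub>C\<^esub> b))"
        using fA mem f_inv by (simp add: A.is_group C.is_group)
      then show ?thesis using b subgroup.m_inv_closed[OF BC] unfolding N_def by blast
    qed
    show "a \<otimes>\<^bsub>?S\<^esub> a' \<in> N" if a: "a \<in> N" "a' \<in> N" for a a'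
    proof -
      obtain b b' where b: "b \<in> B" "a = (f b, inv\<^bsub>C\<^esub> b)" "b' \<in> B" "a' = (f b', inv\<^bsub>C\<^esub> b')"
        using a by (auto simp: N_def)
      then have "a \<otimes>\<^bsub>?S\<^esub> a' = (f (b \<otimes>\<^bsub>C\<^esub> b'), inv\<^bsub>C\<^esub> (b \<otimes>\<^bsub>C\<^esub> b'))"
        using mem f_mult by (simp add: C.inv_mult)
      then show ?thesis using b subgroup.m_closed[OF BC] unfolding N_def by blast
    qed
  qed
  interpret N: normal N ?S using N S.normal_iff_subgroup by blast
  let ?Q = "?S Mod N"
  have Q: "comm_group ?Q" using S.abelian_FactGroup[OF N] .
  interpret Q: comm_group ?Q by (rule Q)
  \<comment> \<open>The tags 0 and 1 tell the two components apart, so an unordered set can encode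
    an ordered pair.\<close>
  define \<psi> where "\<psi> = (\<lambda>(a, c). {(a, 0::nat), (j c, 1)})"
  have "inj_on \<psi> (carrier ?S)"
    using j by (auto simp: inj_on_def \<psi>_def doubleton_eq_iff)
  then obtain \<phi> :: "('a \<times> 'c) set \<Rightarrow> ('a \<times> nat) set" where \<phi>: "inj_on \<phi> (carrier ?Q)"
    using S.inj_on_rcosets_of_inj_on[OF N] by blast
  define G where "G = image_group \<phi> ?Q"
  have G: "comm_group G" and \<phi>_iso: "\<phi> \<in> iso ?Q G"
    unfolding G_def using image_group_iso[OF Q \<phi>] by auto
  interpret G: comm_group G by (rule G)
  define \<iota> where "\<iota> = (\<lambda>a. N #>\<^bsub>?S\<^esub> (a, \<one>\<^bsub>C\<^esub>))"
  have \<iota>_hom: "\<iota> \<in> hom A ?Q"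
  proof -
    have "(\<lambda>a. (a, \<one>\<^bsub>C\<^esub>)) \<in> hom A ?S" by (auto simp: hom_def)
    from hom_compose[OF this N.r_coset_hom_Mod] show ?thesis by (simp add: \<iota>_def comp_def)
  qed
  have "pure_embedding A ?Q \<iota>"
  proof (rule pure_embeddingI)
    show "inj_on \<iota> (carrier A)"
    proof -
      interpret \<iota>: group_hom A ?Q \<iota> using \<iota>_hom by (simp add: group_hom_def group_hom_axioms_def)
      have "a = \<one>\<^bsub>A\<^esub>" if a: "a \<in> carrier A" "\<iota> a = \<one>\<^bsub>?Q\<^esub>" for a
      proof -
        have "(a, \<one>\<^bsub>C\<^esub>) \<in> N" using a S.coset_join1[OF _ _ N, of "(a, \<one>\<^bsub>C\<^esub>)"] N.subset by (simp add: \<iota>_def)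
        then obtain b where b: "b \<in> B" "a = f b" "inv\<^bsub>C\<^esub> b = \<one>\<^bsub>C\<^esub>" by (auto simp: N_def)
        then have "b = \<one>\<^bsub>C\<^esub>" using mem by (metis C.inv_inv C.inv_one)
        then show ?thesis using b f_one by simp
      qed
      then show ?thesis by (simp add: \<iota>.inj_on_one_iff)
    qed
    show "\<exists>a'\<in>carrier A. a = a' [^]\<^bsub>A\<^esub> k"
      if a: "a \<in> carrier A" and Y: "Y \<in> carrier ?Q" and k: "1 \<le> k" and eq: "\<iota> a = Y [^]\<^bsub>?Q\<^esub> k"
      for a Y and k :: nat
    proof -
      obtain x c where xc: "x \<in> carrier A" "c \<in> carrier C" "Y = N #>\<^bsub>?S\<^esub> (x, c)"
        using Y by (auto simp: carrier_FactGroup)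
      have "\<iota> a = N #>\<^bsub>?S\<^esub> (x [^]\<^bsub>A\<^esub> k, c [^]\<^bsub>C\<^esub> k)"
        using eq xc N.FactGroup_pow[of "(x, c)" k] by (simp add: nat_pow_DirProd)
      moreover have "(a, \<one>\<^bsub>C\<^esub>) \<in> \<iota> a" unfolding \<iota>_def using a by (intro S.rcos_self[OF _ N]) simp
      ultimately obtain b where b: "b \<in> B" "a = f b \<otimes>\<^bsub>A\<^esub> x [^]\<^bsub>A\<^esub> k" "\<one>\<^bsub>C\<^esub> = inv\<^bsub>C\<^esub> b \<otimes>\<^bsub>C\<^esub> c [^]\<^bsub>C\<^esub> k"
        by (auto simp: r_coset_def N_def)
      then have "b = c [^]\<^bsub>C\<^esub> k"
        using mem xc by (metis C.inv_closed C.inv_inv C.inv_equality C.m_comm C.nat_pow_closed)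
      \<comment> \<open>The \<open>C\<close>-component has exhibited \<open>b\<close> as a
        \<open>k\<close>-th power in \<open>C\<close>. Purity of \<open>B\<close> moves the root
        into \<open>B\<close>, where \<open>f\<close> is defined and carries it to
        \<open>A\<close>.\<close>
      then obtain b' where b': "b' \<in> B" "b = b' [^]\<^bsub>C\<^esub> k"
        using B b xc k unfolding pure_subgroup_def by metis
      then have "a = (f b' \<otimes>\<^bsub>A\<^esub> x) [^]\<^bsub>A\<^esub> k"
        using b xc fA f_pow by (simp add: A.nat_pow_distrib)
      then show ?thesis using fA b' xc by blast
    qed
  qed (use \<iota>_hom A.is_group Q.is_group in auto)
  then have pe: "pure_embedding A G (\<phi> \<circ> \<iota>)"
    using pure_embedding_comp iso_imp_pure_embedding \<phi>_iso A.is_group Q.is_group G.is_group by metis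
  then have summand: "direct_summand ((\<phi> \<circ> \<iota>) ` carrier A) G"
    using A(2) G unfolding algebraically_compact_def by blast
  let ?I = "G\<lparr>carrier := (\<phi> \<circ> \<iota>) ` carrier A\<rparr>"
  obtain r where r: "r \<in> hom G ?I" "\<And>x. x \<in> (\<phi> \<circ> \<iota>) ` carrier A \<Longrightarrow> r x = x"
    using direct_summand_retraction[OF G summand] by blast
  have "\<phi> \<circ> \<iota> \<in> iso A ?I"
    using pure_embedding_hom[OF pe] pure_embedding_inj[OF pe]
    by (auto simp: iso_def hom_def bij_betw_def)
  then have inv_hom: "inv_into (carrier A) (\<phi> \<circ> \<iota>) \<in> hom ?I A"
    using A.iso_set_sym[of "\<phi> \<circ> \<iota>" ?I] unfolding iso_def by blast
  \<comment> \<open>\<open>C\<close> enters the pushout, its transported copy is retracted onto the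
    copy of \<open>A\<close>, and that copy is read back in \<open>A\<close>.\<close>
  define h where "h = inv_into (carrier A) (\<phi> \<circ> \<iota>) \<circ> (r \<circ> (\<phi> \<circ> ((\<lambda>x. N #>\<^bsub>?S\<^esub> x) \<circ> (\<lambda>c. (\<one>\<^bsub>A\<^esub>, c)))))"
  have "(\<lambda>c. (\<one>\<^bsub>A\<^esub>, c)) \<in> hom C ?S" by (auto simp: hom_def)
  moreover have "\<phi> \<in> hom ?Q G" using \<phi>_iso by (simp add: iso_def)
  ultimately have "h \<in> hom C A"
    unfolding h_def using hom_compose N.r_coset_hom_Mod r(1) inv_hom by metis
  moreover have "h b = f b" if b: "b \<in> B" for b
  proof -
    have "(f b, inv\<^bsub>C\<^esub> b) \<in> N" "(\<one>\<^bsub>A\<^esub>, b) \<in> carrier ?S" using b mem by (auto simp: N_def)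
    then have "N #>\<^bsub>?S\<^esub> ((f b, inv\<^bsub>C\<^esub> b) \<otimes>\<^bsub>?S\<^esub> (\<one>\<^bsub>A\<^esub>, b)) = N #>\<^bsub>?S\<^esub> (\<one>\<^bsub>A\<^esub>, b)"
      by (rule S.rcos_absorb[OF N])
    then have "N #>\<^bsub>?S\<^esub> (\<one>\<^bsub>A\<^esub>, b) = \<iota> (f b)" using b fA mem by (simp add: \<iota>_def)
    then have "h b = inv_into (carrier A) (\<phi> \<circ> \<iota>) (r ((\<phi> \<circ> \<iota>) (f b)))" by (simp add: h_def)
    also have "r ((\<phi> \<circ> \<iota>) (f b)) = (\<phi> \<circ> \<iota>) (f b)" using r(2) fA[OF b] by blast
    also have "inv_into (carrier A) (\<phi> \<circ> \<iota>) ((\<phi> \<circ> \<iota>) (f b)) = f b"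
      using pure_embedding_inj[OF pe] fA[OF b] by (rule inv_into_f_f)
    finally show ?thesis .
  qed
  ultimately show ?thesis by blast
qed

section \<open>Construction of the extension\<close>

text \<open>It serves twice: for the quotient of \<open>C\<close> by \<open>B\<close>, to obtain the
  second summand, and for \<open>C\<close> itself, to bound its size.\<close>

lemma pure_embedding_into_group_above_GG:
  assumes "comm_group H" "|carrier H| \<le>o |Field \<mu>|" "infinite (Field \<mu>)"
    and Q: "group Q" and P: "pure_subgroup P Q" and iso: "Q\<lparr>carrier := P\<rparr> \<cong> GG \<mu>"
  shows "\<exists>e. pure_embedding H Q e"
proof -
  have sub: "group (Q\<lparr>carrier := P\<rparr>)"
    using P Q by (simp add: pure_subgroup_def group.subgroup_imp_group)
  obtain \<phi> where \<phi>: "\<phi> \<in> iso (GG \<mu>) (Q\<lparr>carrier := P\<rparr>)"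
    using group.iso_sym[OF sub iso] by (auto simp: is_iso_def)
  obtain e where e: "pure_embedding H (GG \<mu>) e" using pure_embedding_into_GG assms(1-3) by blast
  have H: "group H" using assms(1) by (rule comm_group.axioms(2))
  have "pure_embedding H (Q\<lparr>carrier := P\<rparr>) (\<phi> \<circ> e)"
    using pure_embedding_comp[OF H GG_group sub e iso_imp_pure_embedding[OF GG_group sub \<phi>]] .
  from pure_embedding_comp[OF H sub Q this pure_subgroup_inclusion[OF Q P]]
  show ?thesis by blast
qed

text \<open>A copy of \<open>A\<close> inside \<open>Field \<kappa>\<close> puts the cardinal on the
  type of \<open>\<kappa>\<close>. Since \<open>A\<close> may be finite, a countably infinite subset
  is adjoined; the union stays below \<open>\<kappa>\<close> because \<open>\<kappa>\<close> is
  uncountable.\<close>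

lemma infinite_cardinal_between:
  fixes \<kappa> :: "'k rel"
  assumes \<kappa>: "Card_order \<kappa>" "natLeq <o \<kappa>" and A: "|A| <o \<kappa>"
  obtains \<mu> :: "'k rel" where "Card_order \<mu>" "cinfinite \<mu>" "\<mu> <o \<kappa>" "|A| \<le>o |Field \<mu>|"
proof -
  have \<kappa>F: "|Field \<kappa>| =o \<kappa>" using \<kappa>(1) by (rule card_of_Field_ordIso)
  have "natLeq \<le>o |Field \<kappa>|"
    using \<kappa>(2) \<kappa>F ordIso_symmetric ordLess_imp_ordLeq ordLeq_ordIso_trans by blast
  then have inf: "infinite (Field \<kappa>)" using infinite_iff_natLeq_ordLeq by blast
  then obtain g :: "nat \<Rightarrow> 'k" where g: "inj g" "range g \<subseteq> Field \<kappa>"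
    using infinite_countable_subset by blast
  have "|A| \<le>o |Field \<kappa>|"
    using A \<kappa>F ordIso_symmetric ordLess_imp_ordLeq ordLeq_ordIso_trans by blast
  then obtain i where i: "inj_on i A" "i ` A \<subseteq> Field \<kappa>" using card_of_ordLeq[of A "Field \<kappa>"] by blast
  have "|i ` A| <o \<kappa>" using card_of_image A by (rule ordLeq_ordLess_trans)
  moreover have "|range g| <o \<kappa>"
    using card_of_image[of g UNIV] card_of_nat \<kappa>(2) ordLeq_ordIso_trans ordLeq_ordLess_trans by blast
  ultimately have lt: "|i ` A \<union> range g| <o \<kappa>"
    using inf \<kappa>(1) by (intro card_of_Un_ordLess_infinite_Field)
  have "|A| \<le>o |i ` A \<union> range g|" using card_of_ordLeq[of A "i ` A \<union> range g"] i by blast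
  then show thesis
    using that[of "|i ` A \<union> range g|"] lt range_inj_infinite[OF g(1)]
    by (simp add: cinfinite_def Field_card_of card_of_card_order_on)
qed

theorem mainTheorem3:
  fixes \<kappa> :: "'k rel" and F :: "'a monoid"
  assumes "strongly_inaccessible \<kappa>"
    and "comm_group F"
    and "\<And>C. subgroup C F \<Longrightarrow> |C| <o \<kappa> \<Longrightarrow>
           \<exists>D. C \<subseteq> D \<and> direct_summand D F \<and> algebraically_compact (F\<lparr>carrier := D\<rparr>) \<and>
             (\<forall>\<mu>::'k rel. Card_order \<mu> \<and> cinfinite \<mu> \<and> \<mu> <o \<kappa> \<longrightarrow>
                (\<exists>P. pure_subgroup P (F Mod D) \<and> (F Mod D)\<lparr>carrier := P\<rparr> \<cong> GG \<mu>))"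
  shows "pure_injective_for {C :: 'c monoid. comm_group C \<and> |carrier C| <o \<kappa>} F"
proof -
  interpret F: comm_group F by fact
  have "\<exists>g. pure_embedding C F g \<and> (\<forall>x\<in>B. g x = f x)"
    if C: "comm_group C" and card: "|carrier C| <o \<kappa>" and B: "pure_subgroup B C"
      and f: "pure_embedding (C\<lparr>carrier := B\<rparr>) F f" for C :: "'c monoid" and B f
  proof -
    interpret C: comm_group C by fact
    have BC: "subgroup B C" using B by (simp add: pure_subgroup_def)
    then interpret B: normal B C using C.normal_iff_subgroup by blast
    have groupB: "group (C\<lparr>carrier := B\<rparr>)" using BC C.subgroup_imp_group by blast
    have "|f ` B| <o \<kappa>"
      using ordLeq_transitive[OF card_of_image card_of_mono1[OF B.subset]] card
      by (rule ordLeq_ordLess_trans)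
    moreover have "subgroup (f ` B) F" using f by (simp add: pure_embedding_def pure_subgroup_def)
    ultimately obtain D where fD: "f ` B \<subseteq> D" and summand: "direct_summand D F"
      and compact: "algebraically_compact (F\<lparr>carrier := D\<rparr>)"
      and GG: "\<And>\<mu>::'k rel. Card_order \<mu> \<Longrightarrow> cinfinite \<mu> \<Longrightarrow> \<mu> <o \<kappa> \<Longrightarrow>
        \<exists>P. pure_subgroup P (F Mod D) \<and> (F Mod D)\<lparr>carrier := P\<rparr> \<cong> GG \<mu>"
      using assms(3) by meson
    have D: "subgroup D F" using summand by (simp add: direct_summand_def)
    then interpret D: normal D F using F.normal_iff_subgroup by blast
    have FD: "group (F Mod D)" by (rule D.factorgroup_is_group)
    obtain \<mu> :: "'k rel" where \<mu>: "Card_order \<mu>" "cinfinite \<mu>" "\<mu> <o \<kappa>" "|carrier C| \<le>o |Field \<mu>|"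
      using infinite_cardinal_between[OF _ _ card] assms(1) by (auto simp: strongly_inaccessible_def)
    then obtain P where P: "pure_subgroup P (F Mod D)" "(F Mod D)\<lparr>carrier := P\<rparr> \<cong> GG \<mu>"
      using GG by blast
    have inf: "infinite (Field \<mu>)" using \<mu>(2) by (simp add: cinfinite_def)
    obtain s where s: "s \<in> hom (F Mod D) F" "\<And>X. X \<in> carrier (F Mod D) \<Longrightarrow> D #>\<^bsub>F\<^esub> s X = X"
      using direct_summand_section[OF assms(2) summand] by blast
    have "|carrier (C Mod B)| \<le>o |Field \<mu>|"
      unfolding carrier_FactGroup using card_of_image \<mu>(4) by (rule ordLeq_transitive)
    then obtain e where e: "pure_embedding (C Mod B) (F Mod D) e"
      using pure_embedding_into_group_above_GG[OF C.abelian_FactGroup[OF BC] _ inf FD P] by blast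
    have e_closed: "e X \<in> carrier (F Mod D)" if "X \<in> carrier (C Mod B)" for X
      using pure_embedding_hom[OF e] that by (auto simp: hom_def)

    \<comment> \<open>The quotient \<open>F Mod D\<close> is already as large as \<open>C\<close>, so \<open>C\<close> fits into the type of \<open>F\<close>.\<close>
    obtain e' where e': "pure_embedding C (F Mod D) e'"
      using pure_embedding_into_group_above_GG[OF C \<mu>(4) inf FD P] by blast
    have "inj_on (s \<circ> e') (carrier C)"
    proof (rule comp_inj_on[OF pure_embedding_inj[OF e']])
      have "inj_on s (carrier (F Mod D))" using s(2) by (metis inj_onI)
      then show "inj_on s (e' ` carrier C)"
        using pure_embedding_hom[OF e'] by (auto simp: hom_def intro: inj_on_subset)
    qed
    moreover have "f \<in> hom (C\<lparr>carrier := B\<rparr>) (F\<lparr>carrier := D\<rparr>)"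
      using pure_embedding_hom[OF f] fD by (auto simp: hom_def)
    moreover have "comm_group (F\<lparr>carrier := D\<rparr>)"
      using D F.subgroup_imp_group by (intro group.group_comm_groupI) (auto simp: F.m_comm)
    ultimately obtain h where h: "h \<in> hom C (F\<lparr>carrier := D\<rparr>)" "\<And>x. x \<in> B \<Longrightarrow> h x = f x"
      using algebraically_compact_extension[OF _ compact C B] by metis
    have hD: "h c \<in> D" if "c \<in> carrier C" for c using h(1) that by (auto simp: hom_def)
    have hF: "h \<in> hom C F" using h(1) D.subset by (auto simp: hom_def)

    define g where "g c = h c \<otimes>\<^bsub>F\<^esub> s (e (B #>\<^bsub>C\<^esub> c))" for c
    have "s \<circ> (e \<circ> (\<lambda>c. B #>\<^bsub>C\<^esub> c)) \<in> hom C F"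
      by (rule hom_compose[OF hom_compose[OF B.r_coset_hom_Mod pure_embedding_hom[OF e]] s(1)])
    from F.hom_group_mult[OF hF this] have g: "g \<in> hom C F"
      by (simp add: g_def[abs_def])
    interpret g: group_hom C F g using g by unfold_locales
    interpret e: group_hom "C Mod B" "F Mod D" e
      using pure_embedding_hom[OF e] B.factorgroup_is_group FD
      by (simp add: group_hom_def group_hom_axioms_def)
    interpret s: group_hom "F Mod D" F s
      using s(1) FD by (simp add: group_hom_def group_hom_axioms_def F.is_group)
    have coset: "B #>\<^bsub>C\<^esub> c \<in> carrier (C Mod B)" if "c \<in> carrier C" for c
      using that by (auto simp: carrier_FactGroup)
    \<comment> \<open>The value of \<open>h\<close> lies in \<open>D\<close> and \<open>s\<close> is
      a section, so modulo \<open>D\<close> only \<open>e\<close> remains. Injectivity and purity of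
      \<open>g\<close> both start from this.\<close>
    have Dg: "D #>\<^bsub>F\<^esub> g c = e (B #>\<^bsub>C\<^esub> c)" if c: "c \<in> carrier C" for c
      unfolding g_def using F.rcos_absorb[OF D hD[OF c]] s(2) e_closed coset[OF c] by simp
    have gB: "g b = f b" if b: "b \<in> B" for b
    proof -
      have "B #>\<^bsub>C\<^esub> b = \<one>\<^bsub>C Mod B\<^esub>" using b BC C.coset_join2 by auto
      then have "s (e (B #>\<^bsub>C\<^esub> b)) = \<one>\<^bsub>F\<^esub>" using e.hom_one s.hom_one by metis
      moreover have "f b \<in> carrier F" using fD b D.subset by auto
      ultimately show ?thesis using h(2)[OF b] by (simp add: g_def)
    qed
    have "pure_embedding C F g"
    proof (rule pure_embeddingI)
      show "inj_on g (carrier C)"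
      proof -
        have "c = \<one>\<^bsub>C\<^esub>" if c: "c \<in> carrier C" "g c = \<one>\<^bsub>F\<^esub>" for c
        proof -
          \<comment> \<open>The kernel of \<open>g\<close> is thereby confined to \<open>B\<close>,
            where \<open>g\<close> is the injective map \<open>f\<close>.\<close>
          have "e (B #>\<^bsub>C\<^esub> c) = \<one>\<^bsub>F Mod D\<^esub>"
            using Dg[OF c(1)] c(2) F.coset_join2[OF F.one_closed D] D.one_closed by simp
          then have "e (B #>\<^bsub>C\<^esub> c) = e \<one>\<^bsub>C Mod B\<^esub>" using e.hom_one by simp
          then have "B #>\<^bsub>C\<^esub> c = B"
            using pure_embedding_inj[OF e] coset[OF c(1)] e.G.one_closed by (metis inj_onD one_FactGroup)
          then have cB: "c \<in> B" using c BC C.rcos_self by metis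
          then have "f c = \<one>\<^bsub>F\<^esub>" using gB c by metis
          moreover have "f \<one>\<^bsub>C\<^esub> = \<one>\<^bsub>F\<^esub>" using gB B.one_closed g.hom_one by metis
          ultimately show ?thesis
            using pure_embedding_inj[OF f] cB B.one_closed by (simp add: inj_on_def)
        qed
        then show ?thesis by (simp add: g.inj_on_one_iff)
      qed
      show "\<exists>c'\<in>carrier C. c = c' [^]\<^bsub>C\<^esub> k"
        if c: "c \<in> carrier C" and x: "x \<in> carrier F" and k: "1 \<le> k" and eq: "g c = x [^]\<^bsub>F\<^esub> k"
        for c x and k :: nat
      proof -
        have "e (B #>\<^bsub>C\<^esub> c) = (D #>\<^bsub>F\<^esub> x) [^]\<^bsub>F Mod D\<^esub> k"
          using Dg[OF c] eq D.FactGroup_pow[OF x] by simp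
        moreover have "D #>\<^bsub>F\<^esub> x \<in> carrier (F Mod D)" using x by (auto simp: carrier_FactGroup)
        ultimately obtain Y where "Y \<in> carrier (C Mod B)" "B #>\<^bsub>C\<^esub> c = Y [^]\<^bsub>C Mod B\<^esub> k"
          using pure_embedding_root[OF e B.factorgroup_is_group FD coset[OF c] _ k] by blast
        then obtain y where y: "y \<in> carrier C" "B #>\<^bsub>C\<^esub> c = B #>\<^bsub>C\<^esub> (y [^]\<^bsub>C\<^esub> k)"
          using B.FactGroup_pow by (auto simp: carrier_FactGroup)
        then have "c \<in> B #>\<^bsub>C\<^esub> (y [^]\<^bsub>C\<^esub> k)" using C.rcos_self[OF c BC] by simp
        then obtain b where b: "b \<in> B" "c = b \<otimes>\<^bsub>C\<^esub> y [^]\<^bsub>C\<^esub> k" by (auto simp: r_coset_def)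
        \<comment> \<open>Dividing by the power of \<open>g y\<close> makes \<open>f b\<close> a
          \<open>k\<close>-th power in \<open>F\<close>. Its root there may lie outside the image of
          \<open>f\<close>; purity of \<open>f\<close> replaces it by one coming from
          \<open>B\<close>.\<close>
        have "x [^]\<^bsub>F\<^esub> k = f b \<otimes>\<^bsub>F\<^esub> g y [^]\<^bsub>F\<^esub> k"
          using eq b y gB g.hom_nat_pow by simp
        moreover have fb: "f b \<in> carrier F" using fD b D.subset by auto
        ultimately have "f b = x [^]\<^bsub>F\<^esub> k \<otimes>\<^bsub>F\<^esub> inv\<^bsub>F\<^esub> (g y [^]\<^bsub>F\<^esub> k)"
          using y by (simp add: F.m_assoc)
        also have "\<dots> = (x \<otimes>\<^bsub>F\<^esub> inv\<^bsub>F\<^esub> g y) [^]\<^bsub>F\<^esub> k"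
          using x y by (simp add: F.nat_pow_distrib F.nat_pow_inv)
        finally obtain b' where "b' \<in> B" "b = b' [^]\<^bsub>C\<lparr>carrier := B\<rparr>\<^esub> k"
          using pure_embedding_root[OF f groupB F.is_group _ _ k, of b "x \<otimes>\<^bsub>F\<^esub> inv\<^bsub>F\<^esub> g y"] b x y
          by auto
        then have "b' \<in> carrier C" "b = b' [^]\<^bsub>C\<^esub> k"
          using C.nat_pow_consistent[of b' k B] B.subset by auto
        then have "c = (b' \<otimes>\<^bsub>C\<^esub> y) [^]\<^bsub>C\<^esub> k" "b' \<otimes>\<^bsub>C\<^esub> y \<in> carrier C"
          using b y by (simp_all add: C.nat_pow_distrib)
        then show ?thesis by blast
      qed
    qed (use g C.is_group F.is_group in auto)
    then show ?thesis using gB by blast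
  qed
  then show ?thesis unfolding pure_injective_for_def by auto
qed

end
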